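(* Let $G$ and $H$ be two nontrivial connected graphs, at least one of which is nonbipartite. If $diam(G)\leq2$, $diam(H)\leq2$, every edge of $G$ lies in a triangle of $G$ and every edge of $H$ lies in a triangle of $H$, then $pvc(G\times H)=spvc(G\times H)=1$; otherwise $pvc(G\times H)=2$.
   Context: All graphs are simple, finite and undirected; nontrivial means having at least two vertices. The direct product $G\times H$ has vertex set $V(G)\times V(H)$, with $(g,h)$ adjacent to $(g',h')$ iff $gg'\in E(G)$ and $hh'\in E(H)$. In a vertex-colored graph, a path is vertex-proper if any two adjacent internal vertices of the path receive different colors. $pvc(G)$ is the smallest number of colors in a vertex-coloring of a connected graph $G$ such that any two vertices are joined by a vertex-proper path, with $pvc(G)=0$ for complete $G$. A $u$-$v$ geodesic is a $u$-$v$ path of length $d(u,v)$; $spvc(G)$ is the smallest number of colors in a vertex-coloring such that any two vertices $u,v$ are joined by a vertex-proper $u$-$v$ geodesic, with $spvc(G)=0$ for complete $G$. *)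

theory Defs
  imports "Graph_Theory.Graph_Theory"
begin

text \<open>
  A simple finite undirected graph is a \<open>pair_graph\<close>: the edge \<open>uv\<close> is the pair of arcs
  \<open>(u, v)\<close>, \<open>(v, u)\<close>. The notions below make sense for every \<open>pre_digraph\<close>; a \<open>pair_graph\<close>
  is passed to them through \<open>with_proj\<close>.
\<close>

definition bipartite :: "('a, 'b) pre_digraph \<Rightarrow> bool" where
  "bipartite G \<longleftrightarrow> (\<exists>U V. verts G = U \<union> V \<and> U \<inter> V = {} \<and> arcs_ends G \<subseteq> U \<times> V \<union> V \<times> U)"

text \<open>The three vertices are distinct as soon as \<open>G\<close> has no loops.\<close>

definition every_edge_in_triangle :: "('a, 'b) pre_digraph \<Rightarrow> bool" where
  "every_edge_in_triangle G \<longleftrightarrow> (\<forall>u v. u \<rightarrow>\<^bsub>G\<^esub> v \<longrightarrow> (\<exists>w. v \<rightarrow>\<^bsub>G\<^esub> w \<and> w \<rightarrow>\<^bsub>G\<^esub> u))"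

definition graph_distance :: "('a, 'b) pre_digraph \<Rightarrow> 'a \<Rightarrow> 'a \<Rightarrow> ereal" where
  "graph_distance G u v = wf_digraph.\<mu> G (\<lambda>_. 1) u v"

definition graph_diameter :: "('a, 'b) pre_digraph \<Rightarrow> ereal" where
  "graph_diameter G = (SUP (u, v) \<in> verts G \<times> verts G. graph_distance G u v)"

definition direct_product ::
    "'a pair_pre_digraph \<Rightarrow> 'b pair_pre_digraph \<Rightarrow> ('a \<times> 'b) pair_pre_digraph" where
  "direct_product G H =
    \<lparr> pverts = pverts G \<times> pverts H,
      parcs = {((g, h), (g', h')) | g h g' h'. (g, g') \<in> parcs G \<and> (h, h') \<in> parcs H} \<rparr>"

definition complete_graph :: "('a, 'b) pre_digraph \<Rightarrow> bool" where
  "complete_graph G \<longleftrightarrow> complete_digraph (card (verts G)) G"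

definition geodesic :: "('a, 'b) pre_digraph \<Rightarrow> 'a \<Rightarrow> 'b awalk \<Rightarrow> 'a \<Rightarrow> bool" where
  "geodesic G u p v \<longleftrightarrow> pre_digraph.apath G u p v \<and> ereal (real (length p)) = graph_distance G u v"

text \<open>
  Adjacency of internal vertices is adjacency along the path: the vertices in \<open>inner_verts\<close>
  are listed in path order, so it means being consecutive in that list.
\<close>

definition vertex_proper :: "('a, 'b) pre_digraph \<Rightarrow> ('a \<Rightarrow> nat) \<Rightarrow> 'b awalk \<Rightarrow> bool" where
  "vertex_proper G c p \<longleftrightarrow> distinct_adj (map c (pre_digraph.inner_verts G p))"

text \<open>
  In \<open>pvc\<close> and \<open>spvc\<close> the number of colours of \<open>c\<close> is the number of colours it uses on
  \<open>verts G\<close>. If \<open>G\<close> is finite, connected and not complete, the minimum exists, as an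
  injective colouring qualifies; otherwise the \<open>LEAST\<close> need not be meaningful.
\<close>

definition pvc :: "('a, 'b) pre_digraph \<Rightarrow> nat" where
  "pvc G = (if complete_graph G then 0 else
    (LEAST k. \<exists>c. card (c ` verts G) = k \<and>
      (\<forall>u \<in> verts G. \<forall>v \<in> verts G. \<exists>p. pre_digraph.apath G u p v \<and> vertex_proper G c p)))"

definition spvc :: "('a, 'b) pre_digraph \<Rightarrow> nat" where
  "spvc G = (if complete_graph G then 0 else
    (LEAST k. \<exists>c. card (c ` verts G) = k \<and>
      (\<forall>u \<in> verts G. \<forall>v \<in> verts G. \<exists>p. geodesic G u p v \<and> vertex_proper G c p)))"

end

theory Submission
  imports Defs
begin

text \<open>
  With one colour, a path is vertex-proper iff it has length at most 2, so \<open>pvc\<close> of a noncomplete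
  graph is 1 iff the diameter is at most 2; the same geodesics then witness \<open>spvc\<close>. In
  \<open>G \<times> H\<close> the vertices \<open>(g, h)\<close> and \<open>(g, h')\<close> with \<open>h \<noteq> h'\<close> are never adjacent, hence diameter at most
  2 means that any two vertices of \<open>G\<close>, and any two vertices of \<open>H\<close>, equal or adjacent ones
  included, have a common neighbour; this is the condition on diameters and triangles.
  Two colours always suffice for a connected graph: colour by the parity of the distance to a root;
  the edges that change the parity form a connected spanning subgraph, and its paths
  are vertex-proper. Connectedness of \<open>G \<times> H\<close> comes from walks of both parities in the
  nonbipartite factor, padded to the length of a walk in the other factor.
\<close>

section \<open>Walks as powers of the adjacency relation\<close>

lemma relpow_symD:
  assumes "sym R" and "(x, y) \<in> R ^^ n"
  shows "(y, x) \<in> R ^^ n"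
  using assms(2)
proof (induction n arbitrary: y)
  case (Suc n)
  then obtain z where "(x, z) \<in> R ^^ n" "(z, y) \<in> R" by auto
  with Suc.IH assms(1) show ?case by (meson relpow_Suc_I2 symD)
qed auto

lemma relpow_trans:
  assumes "(x, y) \<in> R ^^ m" and "(y, z) \<in> R ^^ n"
  shows "(x, z) \<in> R ^^ (m + n)"
  using assms by (auto simp: relpow_add)

text \<open>Stepping to the neighbour \<open>z\<close> and back lengthens a walk by two, so walks of
  equal parity in two graphs can be brought to a common length.\<close>

lemma relpow_pad:
  assumes "sym R" and "(y, z) \<in> R" and "(x, y) \<in> R ^^ n"
  shows "(x, y) \<in> R ^^ (n + 2 * k)"
proof (induction k)
  case (Suc k)
  have "(x, y) \<in> R ^^ Suc (Suc (n + 2 * k))"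
    using Suc assms(1,2) by (meson relpow_Suc_I symD)
  then show ?case by simp
qed (use assms in simp)

context pair_wf_digraph begin

text \<open>Arc walks are traded for relation powers because these split into coordinates in a
  direct product. The assumption on \<open>u\<close> matters for \<open>n = 0\<close>: the empty
  walk exists only at a vertex, whereas \<open>R ^^ 0\<close> is the identity on the whole
  type.\<close>

lemma awalk_length_iff_relpow:
  assumes "u \<in> pverts G"
  shows "(\<exists>p. awalk u p v \<and> length p = n) \<longleftrightarrow> (u, v) \<in> parcs G ^^ n"
  using assms
proof (induction n arbitrary: u)
  case 0
  then show ?case by (auto simp: awalk_Nil_iff)
next
  case (Suc n)
  show ?case
  proof
    assume "\<exists>p. awalk u p v \<and> length p = Suc n"
    then obtain e p where *: "e \<in> parcs G" "fst e = u" "awalk (snd e) p v" "length p = n"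
      by (auto simp: length_Suc_conv awalk_Cons_iff)
    then have "(snd e, v) \<in> parcs G ^^ n"
      using Suc.IH[of "snd e"] arc_snd_in_verts by blast
    with * show "(u, v) \<in> parcs G ^^ Suc n"
      by (metis prod.collapse relpow_Suc_I2)
  next
    assume "(u, v) \<in> parcs G ^^ Suc n"
    then obtain w where w: "(u, w) \<in> parcs G" "(w, v) \<in> parcs G ^^ n"
      by (meson relpow_Suc_D2)
    then obtain p where "awalk w p v" "length p = n"
      using Suc.IH[of w] in_arcsD2 by blast
    with w show "\<exists>p. awalk u p v \<and> length p = Suc n"
      by (intro exI[of _ "(u, w) # p"]) (auto simp: awalk_Cons_iff)
  qed
qed

end

section \<open>Geodesics and the diameter\<close>

context wf_digraph begin

lemma graph_distance_eq:
  "graph_distance G u v = (INF p\<in>{p. awalk u p v}. ereal (real (length p)))"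
proof -
  have "awalk_cost (\<lambda>_. 1) p = real (length p)" for p
    by (induction p) auto
  then show ?thesis unfolding graph_distance_def \<mu>_def by simp
qed

lemma graph_distance_le_iff:
  "graph_distance G u v \<le> ereal (real k) \<longleftrightarrow> (\<exists>p. awalk u p v \<and> length p \<le> k)"
proof
  assume "graph_distance G u v \<le> ereal (real k)"
  \<comment> \<open>A strict upper bound on an infimum yields a member below it, here a walk shorter
    than \<open>Suc k\<close>.\<close>
  also have "\<dots> < ereal (real (Suc k))" by simp
  finally show "\<exists>p. awalk u p v \<and> length p \<le> k"
    unfolding graph_distance_eq by (auto simp: INF_less_iff simp del: of_nat_Suc)
next
  assume "\<exists>p. awalk u p v \<and> length p \<le> k"
  then obtain p where "awalk u p v" "length p \<le> k" by blast
  then show "graph_distance G u v \<le> ereal (real k)"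
    unfolding graph_distance_eq by (intro INF_lower2[of p]) auto
qed

lemma graph_diameter_le_iff:
  "graph_diameter G \<le> ereal (real k) \<longleftrightarrow>
     (\<forall>u \<in> verts G. \<forall>v \<in> verts G. \<exists>p. awalk u p v \<and> length p \<le> k)"
  unfolding graph_diameter_def by (auto simp: SUP_le_iff graph_distance_le_iff)

text \<open>Every reduction step of \<open>awalk_to_apath\<close> deletes a closed subwalk
  \<open>r\<close> from \<open>q @ r @ s\<close>.\<close>

lemma awalk_to_apath_length:
  assumes "awalk u p v"
  shows "length (awalk_to_apath p) \<le> length p"
  using assms
proof (induction rule: awalk_to_apath_induct)
  case (path p)
  then show ?case by (auto simp: awalk_to_apath.simps)
next
  case (decomp p q r s)
  then have "length (q @ s) \<le> length p" by (auto elim: awalk_cyc_decompE)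
  with decomp.IH show ?case
    unfolding step_awalk_to_apath[OF decomp.hyps] by linarith
qed

text \<open>A walk of minimal length keeps that length when turned into a path, so the path realises
  the distance.\<close>

lemma geodesic_exists:
  assumes "awalk u p v"
  obtains q where "geodesic G u q v" and "length q \<le> length p"
proof -
  define m where "m = (LEAST n. \<exists>q. awalk u q v \<and> length q = n)"
  have "\<exists>q. awalk u q v \<and> length q = m"
    unfolding m_def by (rule LeastI[of _ "length p"]) (use assms in blast)
  then obtain q0 where q0: "awalk u q0 v" "length q0 = m" by blast
  have min: "m \<le> length q" if "awalk u q v" for q
    unfolding m_def by (rule Least_le) (use that in blast)
  define q where "q = awalk_to_apath q0"
  have q: "apath u q v" unfolding q_def by (rule apath_awalk_to_apath[OF q0(1)])
  have len: "length q = m"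
    using awalk_to_apath_length[OF q0(1)] q0(2) min[OF awalkI_apath[OF q]]
    unfolding q_def by linarith
  have "graph_distance G u v = ereal (real m)"
    unfolding graph_distance_eq
    by (rule INF_eqI) (use min q0 in auto)
  with q len have "geodesic G u q v" by (simp add: geodesic_def)
  moreover have "length q \<le> length p" using len min[OF assms] by simp
  ultimately show ?thesis by (rule that)
qed

end

context pair_wf_digraph begin

lemma graph_diameter_le_2_iff:
  "graph_diameter G \<le> 2 \<longleftrightarrow>
     (\<forall>u \<in> pverts G. \<forall>v \<in> pverts G. \<exists>p. awalk u p v \<and> length p \<le> 2)"
proof -
  have "ereal (real 2) = 2" by simp
  then show ?thesis using graph_diameter_le_iff[of 2] by metis
qed

lemma graph_diameter_le_2_iff_relpow:
  "graph_diameter G \<le> 2 \<longleftrightarrow>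
     (\<forall>u \<in> pverts G. \<forall>v \<in> pverts G. \<exists>n \<le> 2. (u, v) \<in> parcs G ^^ n)"
proof -
  have "(\<exists>p. awalk u p v \<and> length p \<le> 2) \<longleftrightarrow> (\<exists>n \<le> 2. (u, v) \<in> parcs G ^^ n)"
    if "u \<in> pverts G" for u v
    unfolding awalk_length_iff_relpow[OF that, symmetric] by fast
  then show ?thesis unfolding graph_diameter_le_2_iff by simp
qed

end

section \<open>Colourings\<close>

text \<open>Two arcs leave at most one internal vertex, hence no consecutive pair to
  compare.\<close>

lemma vertex_proper_if_short:
  assumes "length p \<le> 2"
  shows "vertex_proper G c p"
proof -
  consider "p = []" | e where "p = [e]" | e f where "p = [e, f]"
    using assms by (cases p rule: remdups_adj.cases) auto
  then show ?thesis
    by cases (auto simp: vertex_proper_def pre_digraph.inner_verts_def)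
qed

context pair_fin_digraph begin

text \<open>A third arc would make \<open>fst f\<close> and \<open>fst g\<close> consecutive
  internal vertices, which a single colour cannot separate.\<close>

lemma short_if_vertex_proper:
  assumes "apath u p v" and "vertex_proper G c p" and "card (c ` pverts G) \<le> 1"
  shows "length p \<le> 2"
proof (rule ccontr)
  assume "\<not> length p \<le> 2"
  then obtain e f g q where p: "p = e # f # g # q"
    by (auto simp: not_le numeral_2_eq_2 Suc_less_eq2 length_Suc_conv dest!: less_imp_Suc_add)
  have "set p \<subseteq> parcs G"
    using awalkI_apath[OF assms(1)] by auto
  then have verts: "fst f \<in> pverts G" "fst g \<in> pverts G"
    using p arc_fst_in_verts by auto
  have "\<forall>a \<in> c ` pverts G. \<forall>b \<in> c ` pverts G. a = b"
    using assms(3) pair_finite_verts by (simp only: card_le_Suc0_iff_eq finite_imageI One_nat_def)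
  then have "c (fst f) = c (fst g)"
    using verts by (meson imageI)
  moreover have "c (fst f) \<noteq> c (fst g)"
    using assms(2) unfolding p by (simp add: vertex_proper_def pre_digraph.inner_verts_def)
  ultimately show False by contradiction
qed

end

lemma vertex_proper_if_arcs_proper:
  assumes "pcas u p v" and "\<And>x y. (x, y) \<in> set p \<Longrightarrow> c x \<noteq> c y"
  shows "vertex_proper (with_proj G) c p"
proof -
  \<comment> \<open>The induction runs over all tails of arcs; \<open>inner_verts\<close> then drops
    the first of them.\<close>
  have "distinct_adj (map c (map fst p))"
    using assms
  proof (induction p arbitrary: u)
    case (Cons e p)
    then have "distinct_adj (map c (map fst p))" by auto
    moreover have "c (fst e) \<noteq> c (snd e)"
      using Cons.prems(2)[of "fst e" "snd e"] by simp
    moreover have "p \<noteq> [] \<Longrightarrow> fst (hd p) = snd e"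
      using Cons.prems(1) by (cases p) auto
    ultimately show ?case
      by (auto simp: distinct_adj_Cons hd_map)
  qed simp
  then show ?thesis
    unfolding vertex_proper_def pre_digraph.inner_verts_def
    by (cases p) (auto dest: distinct_adj_ConsD)
qed

text \<open>Take for \<open>l\<close> the distance from \<open>r\<close>. The last arc of a shortest
  walk leads from distance \<open>n\<close> to \<open>n + 1\<close>, so it changes the parity;
  induction on the distance reaches every vertex by such arcs.\<close>

lemma rtrancl_parity_changing_arcs:
  assumes "\<And>v. v \<in> V \<Longrightarrow> (r, v) \<in> R\<^sup>*" and "R \<subseteq> V \<times> V"
  obtains l :: "'a \<Rightarrow> nat"
  where "\<And>v. v \<in> V \<Longrightarrow> (r, v) \<in> {(x, y) \<in> R. l x mod 2 \<noteq> l y mod 2}\<^sup>*"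
proof -
  define l where "l v = (LEAST n. (r, v) \<in> R ^^ n)" for v
  define T where "T = {(x, y) \<in> R. l x mod 2 \<noteq> l y mod 2}"
  have walk: "(r, v) \<in> R ^^ l v" if "v \<in> V" for v
    using assms(1)[OF that] unfolding l_def rtrancl_power by (rule LeastI_ex)
  have "(r, v) \<in> T\<^sup>*" if "v \<in> V" and "l v = n" for v n
    using that
  proof (induction n arbitrary: v)
    case 0
    then show ?case using walk[of v] by simp
  next
    case (Suc n)
    then obtain x where x: "(r, x) \<in> R ^^ n" "(x, v) \<in> R" using walk[of v] by auto
    with assms(2) have "x \<in> V" by auto
    \<comment> \<open>The walk found through \<open>x\<close> bounds \<open>l x\<close> from above;
      extending a shortest walk to \<open>x\<close> by one arc bounds it from below.\<close>
    have "l x \<le> n" unfolding l_def using x(1) by (rule Least_le)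
    moreover have "l v \<le> Suc (l x)"
      unfolding l_def[of v] using walk[OF \<open>x \<in> V\<close>] x(2) by (intro Least_le) auto
    ultimately have "l x = n" using Suc.prems(2) by simp
    then have "(x, v) \<in> T" unfolding T_def using x(2) Suc.prems(2) by (auto simp: mod_Suc)
    with Suc.IH[OF \<open>x \<in> V\<close> \<open>l x = n\<close>] show ?case by (rule rtrancl_into_rtrancl)
  qed
  then show thesis using that unfolding T_def by blast
qed

lemma (in pair_pseudo_graph) two_colouring_exists:
  assumes conn: "\<And>u v. u \<in> pverts G \<Longrightarrow> v \<in> pverts G \<Longrightarrow> (u, v) \<in> (parcs G)\<^sup>*"
  obtains c :: "'a \<Rightarrow> nat" where "card (c ` pverts G) \<le> 2"
    and "\<And>u v. u \<in> pverts G \<Longrightarrow> v \<in> pverts G \<Longrightarrow> \<exists>p. apath u p v \<and> vertex_proper G c p"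
proof (cases "pverts G = {}")
  case True
  then show thesis by (intro that[of "\<lambda>_. 0"]) auto
next
  case False
  then obtain r where r: "r \<in> pverts G" by blast
  obtain l :: "'a \<Rightarrow> nat" where l:
    "\<And>v. v \<in> pverts G \<Longrightarrow> (r, v) \<in> {(x, y) \<in> parcs G. l x mod 2 \<noteq> l y mod 2}\<^sup>*"
    by (rule rtrancl_parity_changing_arcs[of "pverts G" r "parcs G"])
       (use conn r in \<open>auto dest: in_arcsD1 in_arcsD2\<close>)
  define T where "T = {(x, y) \<in> parcs G. l x mod 2 \<noteq> l y mod 2}"
  define c where "c v = l v mod 2" for v
  have "sym T"
    using pair_sym_arcs unfolding T_def by (auto simp: sym_def symmetric_def)
  \<comment> \<open>Symmetry of \<open>T\<close> lets the walk from \<open>r\<close> to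
    \<open>u\<close> be reversed and then continued from \<open>r\<close> to
    \<open>v\<close>.\<close>
  then have T: "(u, v) \<in> T\<^sup>*" if "u \<in> pverts G" "v \<in> pverts G" for u v
    using l[OF that(1)] l[OF that(2)] unfolding T_def[symmetric]
    by (meson rtrancl_trans sym_rtrancl symD)
  \<comment> \<open>Walks are shortened to paths inside the spanning subgraph \<open>S\<close>, so
    that all arcs of the path still change colour.\<close>
  define S where "S = \<lparr> pverts = pverts G, parcs = T \<rparr>"
  have [simp]: "pverts S = pverts G" "parcs S = T" by (simp_all add: S_def)
  interpret S: pair_wf_digraph S
    by unfold_locales (auto simp: T_def dest: in_arcsD1 in_arcsD2)
  show thesis
  proof (rule that[of c])
    have "c ` pverts G \<subseteq> {0, 1}" unfolding c_def by auto
    then have "card (c ` pverts G) \<le> card {0::nat, 1}" by (intro card_mono) auto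
    then show "card (c ` pverts G) \<le> 2" by simp
  next
    fix u v assume uv: "u \<in> pverts G" "v \<in> pverts G"
    then obtain n where "(u, v) \<in> parcs S ^^ n"
      using T by (auto simp: rtrancl_power)
    then obtain q where "S.awalk u q v"
      using S.awalk_length_iff_relpow[of u v n] uv by auto
    then obtain p where p: "S.apath u p v" using S.apath_awalk_to_apath by blast
    then have arcs: "set p \<subseteq> T" "pcas u p v"
      by (auto simp: S.apath_def S.awalk_def)
    have "apath u p v"
      using p by (auto simp: S.apath_def apath_def S.awalk_def awalk_def T_def)
    moreover have "vertex_proper G c p"
      using arcs by (intro vertex_proper_if_arcs_proper[of u p v]) (auto simp: T_def c_def)
    ultimately show "\<exists>p. apath u p v \<and> vertex_proper G c p" by blast
  qed
qed

section \<open>Values of the connection numbers\<close>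

context pair_pseudo_graph begin

text \<open>Geodesics of length at most 2 are vertex-proper under every colouring, in particular
  under the constant one; a nonempty vertex set forces at least one colour.\<close>

lemma
  assumes "\<not> complete_graph G" and "pverts G \<noteq> {}" and "graph_diameter G \<le> 2"
  shows pvc_eq_1: "pvc G = 1" and spvc_eq_1: "spvc G = 1"
proof -
  have pos: "1 \<le> card (c ` pverts G)" for c :: "'a \<Rightarrow> nat"
    using assms(2) pair_finite_verts by (simp add: Suc_le_eq card_gt_0_iff)
  have geo: "\<exists>p. geodesic G u p v \<and> vertex_proper G c p"
    if uv: "u \<in> pverts G" "v \<in> pverts G" for u v and c :: "'a \<Rightarrow> nat"
  proof -
    obtain p where "awalk u p v" "length p \<le> 2"
      using assms(3)[unfolded graph_diameter_le_2_iff] uv by metis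
    then obtain q where "geodesic G u q v" "length q \<le> 2"
      using geodesic_exists by (metis le_trans)
    then show ?thesis using vertex_proper_if_short by blast
  qed
  have one: "card ((\<lambda>_. 0::nat) ` pverts G) = 1" using assms(2) by (simp add: image_constant_conv)
  have "(LEAST k. \<exists>c :: 'a \<Rightarrow> nat. card (c ` pverts G) = k \<and>
      (\<forall>u \<in> pverts G. \<forall>v \<in> pverts G. \<exists>p. geodesic G u p v \<and> vertex_proper G c p)) = 1"
    by (rule Least_equality)
       (use pos in \<open>auto intro!: exI[of _ "\<lambda>_. 0"] simp: one geo simp del: One_nat_def\<close>)
  then show "spvc G = 1" using assms(1) by (simp add: spvc_def)
  have path: "\<exists>p. apath u p v \<and> vertex_proper G c p"
    if "u \<in> pverts G" "v \<in> pverts G" for u v and c :: "'a \<Rightarrow> nat"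
    using geo[OF that, of c] by (auto simp: geodesic_def)
  have "(LEAST k. \<exists>c :: 'a \<Rightarrow> nat. card (c ` pverts G) = k \<and>
      (\<forall>u \<in> pverts G. \<forall>v \<in> pverts G. \<exists>p. apath u p v \<and> vertex_proper G c p)) = 1"
    by (rule Least_equality)
       (use pos in \<open>auto intro!: exI[of _ "\<lambda>_. 0"] simp: one path simp del: One_nat_def\<close>)
  then show "pvc G = 1" using assms(1) by (simp add: pvc_def)
qed

text \<open>With fewer than two colours all vertex-proper paths would have length at most 2 and so
  bound the diameter; the parity colouring gives the upper bound.\<close>

lemma pvc_eq_2:
  assumes "\<not> complete_graph G"
    and conn: "\<And>u v. u \<in> pverts G \<Longrightarrow> v \<in> pverts G \<Longrightarrow> (u, v) \<in> (parcs G)\<^sup>*"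
    and "\<not> graph_diameter G \<le> 2"
  shows "pvc G = 2"
proof -
  let ?P = "\<lambda>c :: 'a \<Rightarrow> nat. \<forall>u \<in> pverts G. \<forall>v \<in> pverts G. \<exists>p. apath u p v \<and> vertex_proper G c p"
  have lower: "2 \<le> card (c ` pverts G)" if "?P c" for c
  proof (rule ccontr)
    assume "\<not> 2 \<le> card (c ` pverts G)"
    then have "\<forall>u \<in> pverts G. \<forall>v \<in> pverts G. \<exists>p. awalk u p v \<and> length p \<le> 2"
      using that by (fastforce intro: awalkI_apath dest: short_if_vertex_proper)
    then show False using assms(3) unfolding graph_diameter_le_2_iff by blast
  qed
  obtain c :: "'a \<Rightarrow> nat" where c: "card (c ` pverts G) \<le> 2" "?P c"
    using two_colouring_exists conn by metis
  \<comment> \<open>\<open>LEAST\<close> ranges over exact colour counts, so "at most 2" has to be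
    sharpened to an equality.\<close>
  with lower have "card (c ` pverts G) = 2" by (simp add: order_antisym)
  then have "(LEAST k. \<exists>c. card (c ` pverts G) = k \<and> ?P c) = 2"
    by (intro Least_equality) (use c lower in \<open>blast+\<close>)
  then show ?thesis using assms(1) by (simp add: pvc_def)
qed

end

section \<open>Connected graphs\<close>

context pair_graph begin

lemma sym_parcs: "sym (parcs G)"
  using pair_sym_arcs by (simp add: symmetric_def)

text \<open>\<open>connected\<close> concerns the symmetrised graph; since arcs already come in both
  directions, it yields directed walks.\<close>

lemma connected_imp_rtrancl:
  assumes "connected G" and "u \<in> pverts G" and "v \<in> pverts G"
  shows "(u, v) \<in> (parcs G)\<^sup>*"
proof -
  have "strongly_connected G"
    using symmetric_connected_imp_strongly_connected[OF pair_sym_arcs assms(1)] .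
  then have "u \<rightarrow>\<^sup>*\<^bsub>with_proj G\<^esub> v" using assms(2,3) by (auto simp: strongly_connected_def)
  then show ?thesis by (auto dest: reachable_rtranclI)
qed

lemma neighbour_exists:
  assumes "connected G" and "2 \<le> card (pverts G)" and "u \<in> pverts G"
  obtains w where "(u, w) \<in> parcs G"
proof -
  have "\<not> pverts G \<subseteq> {u}"
    using assms(2) card_mono[of "{u}" "pverts G"] by auto
  then obtain v where "v \<in> pverts G" "v \<noteq> u" by blast
  with connected_imp_rtrancl[OF assms(1,3)] show thesis
    by (metis converse_rtranclE that)
qed

text \<open>Vertices are sorted by the parity of walks from \<open>r\<close>. Arcs switch the
  classes, so disjoint classes would be a bipartition. Hence some \<open>x\<close> is reached with
  both parities; going there by one walk and back by the other has odd length.\<close>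

lemma odd_closed_walk_exists:
  assumes "connected G" and "\<not> bipartite G" and "r \<in> pverts G"
  obtains n where "odd n" and "(r, r) \<in> parcs G ^^ n"
proof -
  define U where "U = {v \<in> pverts G. \<exists>n. even n \<and> (r, v) \<in> parcs G ^^ n}"
  define W where "W = {v \<in> pverts G. \<exists>n. odd n \<and> (r, v) \<in> parcs G ^^ n}"
  have un: "pverts G = U \<union> W"
    using connected_imp_rtrancl[OF assms(1,3)] unfolding U_def W_def rtrancl_power by blast
  have step: "(u \<in> U \<longrightarrow> v \<in> W) \<and> (u \<in> W \<longrightarrow> v \<in> U)" if "(u, v) \<in> parcs G" for u v
  proof -
    have "v \<in> pverts G" using that by (rule in_arcsD2)
    moreover have "(r, v) \<in> parcs G ^^ Suc n" if "(r, u) \<in> parcs G ^^ n" for n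
      using that \<open>(u, v) \<in> parcs G\<close> by auto
    moreover have "even (Suc n) \<longleftrightarrow> odd n" for n :: nat by simp
    ultimately show ?thesis unfolding U_def W_def by blast
  qed
  have "arcs_ends G \<subseteq> U \<times> W \<union> W \<times> U"
  proof (rule subrelI)
    fix u v assume "(u, v) \<in> arcs_ends G"
    then have "(u, v) \<in> parcs G" by simp
    with step[OF this] un in_arcsD1[OF this] show "(u, v) \<in> U \<times> W \<union> W \<times> U" by blast
  qed
  then have "U \<inter> W \<noteq> {}" using assms(2) un unfolding bipartite_def by auto
  then obtain x m n where mn: "even m" "odd n" "(r, x) \<in> parcs G ^^ m" "(r, x) \<in> parcs G ^^ n"
    unfolding U_def W_def by blast
  show thesis
  proof (rule that)
    show "odd (m + n)" using mn(1,2) by simp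
    show "(r, r) \<in> parcs G ^^ (m + n)"
      using mn(3) relpow_symD[OF sym_parcs mn(4)] by (rule relpow_trans)
  qed
qed

text \<open>Prefixing an odd closed walk at \<open>u\<close> flips the parity of a walk from
  \<open>u\<close> to \<open>v\<close>.\<close>

lemma walks_of_both_parities:
  assumes "connected G" and "\<not> bipartite G" and "u \<in> pverts G" and "v \<in> pverts G"
  shows "\<exists>n. even n = b \<and> (u, v) \<in> parcs G ^^ n"
proof -
  obtain m where m: "(u, v) \<in> parcs G ^^ m"
    using connected_imp_rtrancl[OF assms(1,3,4)] by (auto simp: rtrancl_power)
  obtain n where "odd n" "(u, u) \<in> parcs G ^^ n"
    using odd_closed_walk_exists[OF assms(1-3)] .
  then have "odd n" "(u, v) \<in> parcs G ^^ (n + m)" using m relpow_trans by auto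
  moreover from this have "even m = b \<or> even (n + m) = b" by auto
  ultimately show ?thesis using m by blast
qed

text \<open>A walk of length exactly 2 is a common neighbour. For equal vertices any neighbour
  serves, for adjacent ones the apex of a triangle, for the others the diameter bound.\<close>

lemma common_neighbours_iff:
  assumes "connected G" and "2 \<le> card (pverts G)"
  shows "pverts G \<times> pverts G \<subseteq> parcs G O parcs G \<longleftrightarrow>
    graph_diameter G \<le> 2 \<and> every_edge_in_triangle G"
proof -
  note diam = graph_diameter_le_2_iff_relpow
  have sq: "parcs G ^^ 2 = parcs G O parcs G" by (simp add: numeral_2_eq_2)
  show ?thesis
  proof (intro iffI conjI)
    assume *: "pverts G \<times> pverts G \<subseteq> parcs G O parcs G"
    then show "graph_diameter G \<le> 2" unfolding diam sq[symmetric] by blast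
    show "every_edge_in_triangle G"
      unfolding every_edge_in_triangle_def
    proof (intro allI impI)
      fix u v assume "u \<rightarrow>\<^bsub>with_proj G\<^esub> v"
      then have "(v, u) \<in> parcs G O parcs G" using * in_arcsD1 in_arcsD2 by auto
      then show "\<exists>w. v \<rightarrow>\<^bsub>with_proj G\<^esub> w \<and> w \<rightarrow>\<^bsub>with_proj G\<^esub> u" by auto
    qed
  next
    assume *: "graph_diameter G \<le> 2 \<and> every_edge_in_triangle G"
    show "pverts G \<times> pverts G \<subseteq> parcs G O parcs G"
    proof clarify
      fix u v assume uv: "u \<in> pverts G" "v \<in> pverts G"
      then obtain n where "n \<le> 2" and n: "(u, v) \<in> parcs G ^^ n"
        using * unfolding diam by blast
      then consider "n = 0" | "n = 1" | "n = 2" by linarith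
      then show "(u, v) \<in> parcs G O parcs G"
      proof cases
        case 1
        then show ?thesis
          using n neighbour_exists[OF assms uv(1)] sym_parcs by (auto dest: symD)
      next
        case 2
        then have "(u, v) \<in> parcs G" using n by simp
        then have "\<exists>w. (v, w) \<in> parcs G \<and> (w, u) \<in> parcs G"
          using * by (auto simp: every_edge_in_triangle_def)
        then show ?thesis using sym_parcs by (blast dest: symD)
      next
        case 3
        then show ?thesis using n sq by simp
      qed
    qed
  qed
qed

end

section \<open>The direct product\<close>

lemma pverts_direct_product [simp]: "pverts (direct_product G H) = pverts G \<times> pverts H"
  by (simp add: direct_product_def)

lemma direct_product_arc_iff [simp]:
  "((g, h), (g', h')) \<in> parcs (direct_product G H) \<longleftrightarrow> (g, g') \<in> parcs G \<and> (h, h') \<in> parcs H"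
  by (simp add: direct_product_def)

text \<open>A walk in the product is a pair of walks in the factors; only their common length links
  the two coordinates.\<close>

lemma direct_product_relpow_iff:
  "((g, h), (g', h')) \<in> parcs (direct_product G H) ^^ n \<longleftrightarrow>
     (g, g') \<in> parcs G ^^ n \<and> (h, h') \<in> parcs H ^^ n"
proof (induction n arbitrary: g' h')
  case (Suc n)
  then show ?case by (auto simp: relcomp_unfold)
qed simp

lemma pair_pseudo_graph_direct_product:
  assumes "pair_graph G" and "pair_graph H"
  shows "pair_pseudo_graph (direct_product G H)"
proof -
  interpret G: pair_graph G by fact
  interpret H: pair_graph H by fact
  have sub: "parcs (direct_product G H) \<subseteq> pverts (direct_product G H) \<times> pverts (direct_product G H)"
    by (auto dest: G.in_arcsD1 G.in_arcsD2 H.in_arcsD1 H.in_arcsD2)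
  have fin: "finite (pverts (direct_product G H))"
    using G.pair_finite_verts H.pair_finite_verts by simp
  show ?thesis
  proof
    show "finite (parcs (direct_product G H))"
      using sub fin by (meson finite_SigmaI finite_subset)
    show "symmetric (direct_product G H)"
      using G.sym_parcs H.sym_parcs by (auto simp: symmetric_def sym_def)
  qed (use sub fin in auto)
qed

lemma direct_product_connected:
  assumes "pair_graph G" and "pair_graph H"
    and "2 \<le> card (pverts G)" and "2 \<le> card (pverts H)"
    and "connected G" and "connected H"
    and "\<not> bipartite G \<or> \<not> bipartite H"
    and "x \<in> pverts (direct_product G H)" and "y \<in> pverts (direct_product G H)"
  shows "(x, y) \<in> (parcs (direct_product G H))\<^sup>*"
proof -
  interpret G: pair_graph G by fact
  interpret H: pair_graph H by fact
  obtain g h g' h' where xy: "x = (g, h)" "y = (g', h')" by (cases x, cases y)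
  then have v: "g \<in> pverts G" "g' \<in> pverts G" "h \<in> pverts H" "h' \<in> pverts H"
    using assms(8,9) by auto
  \<comment> \<open>The walk in the other factor is fixed first; the nonbipartite factor then
    supplies a walk of matching parity.\<close>
  obtain m n where mn: "even m = even n" "(g, g') \<in> parcs G ^^ m" "(h, h') \<in> parcs H ^^ n"
  proof -
    obtain m0 where m0: "(g, g') \<in> parcs G ^^ m0"
      using G.connected_imp_rtrancl[OF assms(5) v(1,2)] by (auto simp: rtrancl_power)
    obtain n0 where n0: "(h, h') \<in> parcs H ^^ n0"
      using H.connected_imp_rtrancl[OF assms(6) v(3,4)] by (auto simp: rtrancl_power)
    show thesis
    proof (cases "bipartite G")
      case False
      then show thesis
        using G.walks_of_both_parities[OF assms(5) False v(1,2), of "even n0"] n0 that by blast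
    next
      case True
      then have "\<not> bipartite H" using assms(7) by simp
      then show thesis
        using H.walks_of_both_parities[OF assms(6) _ v(3,4), of "even m0"] m0 that by metis
    qed
  qed
  obtain a where a: "(g', a) \<in> parcs G" using G.neighbour_exists[OF assms(5,3) v(2)] .
  obtain b where b: "(h', b) \<in> parcs H" using H.neighbour_exists[OF assms(6,4) v(4)] .
  \<comment> \<open>Equal parity makes the difference of the lengths even; half of it is the number
    of detours added to the shorter walk.\<close>
  obtain k l where kl: "m + 2 * k = n + 2 * l"
  proof (cases "m \<le> n")
    case True
    then have "m + 2 * ((n - m) div 2) = n + 2 * 0" using mn(1) by auto
    then show thesis by (rule that)
  next
    case False
    then have "m + 2 * 0 = n + 2 * ((m - n) div 2)" using mn(1) by auto
    then show thesis by (rule that)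
  qed
  have "(g, g') \<in> parcs G ^^ (m + 2 * k)" "(h, h') \<in> parcs H ^^ (n + 2 * l)"
    using relpow_pad[OF G.sym_parcs a mn(2)] relpow_pad[OF H.sym_parcs b mn(3)] by auto
  then have "(x, y) \<in> parcs (direct_product G H) ^^ (m + 2 * k)"
    unfolding xy direct_product_relpow_iff using kl by simp
  then show ?thesis by (rule relpow_imp_rtrancl)
qed

text \<open>For distinct \<open>g\<close>, \<open>g'\<close> the vertices \<open>(g, h)\<close> and
  \<open>(g', h)\<close> are nonadjacent, as \<open>H\<close> has no loops. So a walk of length 2
  joins them, and it projects to a common neighbour of \<open>g\<close> and \<open>g'\<close>.
  Conversely, common neighbours in the two factors pair up.\<close>

lemma direct_product_diameter_le_2_iff:
  assumes "pair_graph G" and "pair_graph H"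
    and "2 \<le> card (pverts G)" and "2 \<le> card (pverts H)"
    and "connected G" and "connected H"
  shows "graph_diameter (direct_product G H) \<le> 2 \<longleftrightarrow>
    pverts G \<times> pverts G \<subseteq> parcs G O parcs G \<and> pverts H \<times> pverts H \<subseteq> parcs H O parcs H"
proof -
  interpret G: pair_graph G by fact
  interpret H: pair_graph H by fact
  let ?P = "direct_product G H"
  interpret P: pair_pseudo_graph ?P by (rule pair_pseudo_graph_direct_product) fact+
  have sq: "R ^^ 2 = R O R" for R :: "('c \<times> 'c) set" by (simp add: numeral_2_eq_2)
  note diam = P.graph_diameter_le_2_iff_relpow
  have closed_G: "(u, u) \<in> parcs G O parcs G" if "u \<in> pverts G" for u
    using G.neighbour_exists[OF assms(5,3) that] G.sym_parcs by (auto dest: symD)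
  have closed_H: "(u, u) \<in> parcs H O parcs H" if "u \<in> pverts H" for u
    using H.neighbour_exists[OF assms(6,4) that] H.sym_parcs by (auto dest: symD)
  have ne: "pverts G \<noteq> {}" "pverts H \<noteq> {}" using assms(3,4) by auto
  have two: "(x, y) \<in> parcs ?P ^^ 2"
    if xy: "graph_diameter ?P \<le> 2" "x \<in> pverts ?P" "y \<in> pverts ?P" "x \<noteq> y" "(x, y) \<notin> parcs ?P" for x y
  proof -
    obtain n where "n \<le> 2" and n: "(x, y) \<in> parcs ?P ^^ n"
      using xy(1-3) unfolding diam by blast
    then consider "n = 0" | "n = 1" | "n = 2" by linarith
    then show ?thesis using n xy(4,5) by cases auto
  qed
  show ?thesis
  proof (intro iffI conjI)
    assume *: "graph_diameter ?P \<le> 2"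
    show "pverts G \<times> pverts G \<subseteq> parcs G O parcs G"
    proof clarify
      fix g g' assume g: "g \<in> pverts G" "g' \<in> pverts G"
      obtain h where h: "h \<in> pverts H" using ne by blast
      show "(g, g') \<in> parcs G O parcs G"
      \<comment> \<open>Equal coordinates give a single product vertex, joined to itself by the
        empty walk; this case goes to a neighbour of \<open>g\<close> and back instead.\<close>
      proof (cases "g = g'")
        case False
        then have "((g, h), (g', h)) \<in> parcs ?P ^^ 2"
          using * g h by (intro two) (auto dest: H.no_loops')
        then show ?thesis unfolding direct_product_relpow_iff unfolding sq by blast
      qed (use closed_G g in simp)
    qed
    show "pverts H \<times> pverts H \<subseteq> parcs H O parcs H"
    proof clarify
      fix h h' assume h: "h \<in> pverts H" "h' \<in> pverts H"
      obtain g where g: "g \<in> pverts G" using ne by blast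
      show "(h, h') \<in> parcs H O parcs H"
      proof (cases "h = h'")
        case False
        then have "((g, h), (g, h')) \<in> parcs ?P ^^ 2"
          using * g h by (intro two) (auto dest: G.no_loops')
        then show ?thesis unfolding direct_product_relpow_iff unfolding sq by blast
      qed (use closed_H h in simp)
    qed
  next
    assume *: "pverts G \<times> pverts G \<subseteq> parcs G O parcs G \<and> pverts H \<times> pverts H \<subseteq> parcs H O parcs H"
    have "(x, y) \<in> parcs ?P ^^ 2" if "x \<in> pverts ?P" "y \<in> pverts ?P" for x y
    proof -
      obtain g h g' h' where xy: "x = (g, h)" "y = (g', h')" by (cases x, cases y)
      show ?thesis using that * unfolding xy direct_product_relpow_iff unfolding sq by auto
    qed
    then show "graph_diameter ?P \<le> 2" unfolding diam by blast
  qed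
qed

text \<open>An arc between two vertices sharing the coordinate \<open>g\<close> would project to a
  loop at \<open>g\<close>.\<close>

lemma direct_product_not_complete:
  assumes "pair_graph G" and "pverts G \<noteq> {}" and "2 \<le> card (pverts H)"
  shows "\<not> complete_graph (direct_product G H)"
proof
  interpret G: pair_graph G by fact
  obtain g where g: "g \<in> pverts G" using assms(2) by blast
  obtain h h' where h: "h \<in> pverts H" "h' \<in> pverts H" "h \<noteq> h'"
    using assms(3) by (metis card_2_iff obtain_subset_with_card_n insert_subset)
  assume "complete_graph (direct_product G H)"
  then have "((g, h), (g, h')) \<in> parcs (direct_product G H)"
    using g h by (auto simp: complete_graph_def complete_digraph_pair_def simp del: direct_product_arc_iff)
  then show False by (auto dest: G.no_loops')
qed

theorem theorem6p3:
  fixes G :: "'a pair_pre_digraph" and H :: "'b pair_pre_digraph"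
  assumes "pair_graph G" and "pair_graph H"
    and "card (pverts G) \<ge> 2" and "card (pverts H) \<ge> 2"
    and "Digraph_Component.connected (with_proj G)"
    and "Digraph_Component.connected (with_proj H)"
    and "\<not> bipartite (with_proj G) \<or> \<not> bipartite (with_proj H)"
  shows "if graph_diameter (with_proj G) \<le> 2 \<and> graph_diameter (with_proj H) \<le> 2 \<and>
            every_edge_in_triangle (with_proj G) \<and> every_edge_in_triangle (with_proj H)
         then pvc (with_proj (direct_product G H)) = 1 \<and> spvc (with_proj (direct_product G H)) = 1
         else pvc (with_proj (direct_product G H)) = 2"
proof -
  let ?P = "direct_product G H"
  interpret P: pair_pseudo_graph ?P
    using assms(1,2) by (rule pair_pseudo_graph_direct_product)
  have ne: "pverts G \<noteq> {}" "pverts H \<noteq> {}" using assms(3,4) by auto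
  have not_complete: "\<not> complete_graph ?P"
    using direct_product_not_complete assms(1,4) ne(1) by blast
  \<comment> \<open>The condition of the theorem amounts to a bound of 2 on the diameter of the
    product, so its two branches are the two cases for \<open>pvc\<close>.\<close>
  have "graph_diameter ?P \<le> 2 \<longleftrightarrow> graph_diameter G \<le> 2 \<and> graph_diameter H \<le> 2 \<and>
      every_edge_in_triangle G \<and> every_edge_in_triangle H"
    unfolding direct_product_diameter_le_2_iff[OF assms(1-6)]
      pair_graph.common_neighbours_iff[OF assms(1,5,3)]
      pair_graph.common_neighbours_iff[OF assms(2,6,4)]
    by blast
  moreover have "pvc ?P = 1 \<and> spvc ?P = 1" if "graph_diameter ?P \<le> 2"
    using P.pvc_eq_1 P.spvc_eq_1 not_complete ne that by simp
  moreover have "pvc ?P = 2" if "\<not> graph_diameter ?P \<le> 2"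
    using P.pvc_eq_2[OF not_complete _ that] direct_product_connected[OF assms] by blast
  ultimately show ?thesis by simp
qed

end
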